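(* For all integers $n,k\geq 2$, $$f(n,k)\geq \min_{t\geq n(k-1)+1}\max\left\{f(n-1,k)+t,\ \frac{t^{1/(k-1)}}{t^{1/(k-1)}-1}\bigl(f(n-2,k)+1\bigr)-1\right\},$$ where the minimum is taken over integers $t\geq n(k-1)+1$.
   Context: All graphs are finite, simple and undirected. For integers $n\geq 0$ and $k\geq 2$, $f(n,k)$ denotes the maximal integer $f$ with the following property: if a graph $G=(V,E)$ contains no odd cycles of length at most $2k-1$ and $|V|\leq f$, then $G$ has a proper vertex coloring in $n$ colors. In particular $f(0,k)=0$ and $f(1,k)=1$. *)

theory Defs
  imports Complex_Main "Graph_Theory.Graph_Theory"
begin

(* A finite simple undirected graph is a pair_graph: a finite, loop-free, symmetric
   digraph without parallel arcs.  Traversing one edge back and forth is a cycle of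
   length 2 in the sense of pre_digraph.cycle, but cycles of odd length in this sense
   are exactly the (rooted, oriented) odd cycles of the undirected graph. *)

definition no_short_odd_cycle :: "nat \<Rightarrow> 'a pair_pre_digraph \<Rightarrow> bool" where
  "no_short_odd_cycle k G \<longleftrightarrow>
     \<not> (\<exists>p. pre_digraph.cycle (with_proj G) p \<and> odd (length p) \<and> length p \<le> 2 * k - 1)"

definition colorable :: "nat \<Rightarrow> 'a pair_pre_digraph \<Rightarrow> bool" where
  "colorable n G \<longleftrightarrow>
     (\<exists>c :: 'a \<Rightarrow> nat. c ` pverts G \<subseteq> {..<n} \<and> (\<forall>(u, v) \<in> parcs G. c u \<noteq> c v))"

definition all_colorable_upto :: "nat \<Rightarrow> nat \<Rightarrow> nat \<Rightarrow> bool" where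
  "all_colorable_upto n k m \<longleftrightarrow>
     (\<forall>G :: nat pair_pre_digraph.
        pair_graph G \<and> no_short_odd_cycle k G \<and> card (pverts G) \<le> m \<longrightarrow> colorable n G)"

(* Every finite graph is isomorphic to one with vertices in nat, so the vertex
   type nat is no restriction.  The maximum exists because there are finite graphs
   of arbitrarily large odd girth and chromatic number. *)
definition max_colorable :: "nat \<Rightarrow> nat \<Rightarrow> nat" where
  "max_colorable n k = (GREATEST m. all_colorable_upto n k m)"

end

theory Submission
  imports Defs "HOL-Library.Ramsey" "HOL-Library.Nat_Bijection"
begin

text \<open>
  Take a non-\<open>n\<close>-colourable graph without short odd cycles on \<open>f(n,k) + 1\<close> vertices; by minimality
  all its proper induced subgraphs are \<open>n\<close>-colourable. A ball of radius at most \<open>k - 1\<close> is bipartite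
  by parity of the distance to its centre, and only its outermost level has neighbours outside.
  Let \<open>t\<close> be the largest size of a ball of radius \<open>k - 1\<close>.

  Every level of a ball has at least \<open>n\<close> vertices, as otherwise a colouring of the outside
  would extend inwards; hence \<open>t \<ge> n(k-1) + 1\<close>. A colouring of the complement of a largest
  ball with \<open>n - 1\<close> colours would extend to the ball using one new colour, so
  \<open>f(n,k) + 1 - t > f(n-1,k)\<close>. Finally, let \<open>r\<close> be the \<open>(k-1)\<close>-th root of \<open>t\<close>. Repeatedly removing
  balls that grow by a factor of at most \<open>r\<close> in the next step yields an induced bipartite subgraph
  on at least the fraction \<open>1/r\<close> of all vertices, whose complement is not \<open>(n-2)\<close>-colourable.

  That \<open>f(n,k)\<close> is finite is witnessed by shift graphs on \<open>k\<close>-element sets: they have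
  unbounded chromatic number by Ramsey's theorem.
\<close>

section \<open>Odd closed walks\<close>

text \<open>Closed walks replace cycles because they survive homomorphisms and concatenation; for
  the arcs of a graph, \<open>no_short_odd_cycle_iff\<close> shows that nothing is lost.\<close>

definition odd_walk_free :: "nat \<Rightarrow> 'a rel \<Rightarrow> bool" where
  "odd_walk_free k R \<longleftrightarrow> (\<forall>l u. odd l \<and> l \<le> 2 * k - 1 \<longrightarrow> (u, u) \<notin> R ^^ l)"

lemma relpow_map:
  assumes "(x, y) \<in> R ^^ n" and "\<And>a b. (a, b) \<in> R \<Longrightarrow> (f a, f b) \<in> S"
  shows "(f x, f y) \<in> S ^^ n"
  using assms(1)
proof (induction n arbitrary: y)
  case (Suc n)
  then show ?case using assms(2) by auto
qed simp

lemma relpow_subset: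
  fixes R S :: "'a rel"
  assumes "R \<subseteq> S"
  shows "R ^^ n \<subseteq> S ^^ n"
proof (rule subrelI)
  fix x y assume "(x, y) \<in> R ^^ n"
  then show "(x, y) \<in> S ^^ n"
    by (rule relpow_map[where f = "\<lambda>x. x"]) (use assms in blast)
qed

lemma odd_walk_free_mono:
  assumes "odd_walk_free k R" "S \<subseteq> R"
  shows "odd_walk_free k S"
  using assms relpow_subset[of S R] unfolding odd_walk_free_def by blast

lemma sym_relpow:
  assumes "sym R"
  shows "sym (R ^^ n)"
proof (induction n)
  case (Suc n)
  show ?case
  proof (rule symI)
    fix x y assume "(x, y) \<in> R ^^ Suc n"
    then obtain z where "(x, z) \<in> R ^^ n" "(z, y) \<in> R"
      by auto
    then have "(y, z) \<in> R" "(z, x) \<in> R ^^ n"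
      using assms Suc.IH by (auto dest: symD)
    then show "(y, x) \<in> R ^^ Suc n"
      by (rule relpow_Suc_I2)
  qed
qed (simp add: sym_def)

section \<open>Closed walks and cycles in a graph\<close>

context pair_wf_digraph
begin

lemma awalk_imp_relpow:
  assumes "awalk u p v"
  shows "(u, v) \<in> parcs G ^^ length p"
  using assms
proof (induction p arbitrary: u)
  case (Cons e p)
  then show ?case
    by (auto simp: awalk_Cons_iff simp del: relpow.simps intro!: relpow_Suc_I2[of _ "snd e"])
qed (auto simp: awalk_Nil_iff)

lemma relpow_imp_awalk:
  assumes "(u, v) \<in> parcs G ^^ n" "u \<in> pverts G"
  shows "\<exists>p. awalk u p v \<and> length p = n"
  using assms
proof (induction n arbitrary: u)
  case 0
  then show ?case by (auto simp: awalk_Nil_iff)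
next
  case (Suc n)
  then obtain w where w: "(u, w) \<in> parcs G" "(w, v) \<in> parcs G ^^ n"
    by (blast dest: relpow_Suc_D2)
  with Suc.IH[of w] obtain p where "awalk w p v" "length p = n"
    using wellformed'(2) by blast
  with w show ?case
    by (intro exI[of _ "(u, w) # p"]) (auto simp: awalk_Cons_iff)
qed

text \<open>A closed walk that is not a cycle splits into two shorter closed walks, one of which is
  again odd.\<close>

lemma odd_closed_walk_imp_cycle:
  assumes "awalk u p u" "odd (length p)"
  shows "\<exists>q. cycle q \<and> odd (length q) \<and> length q \<le> length p"
  using assms
proof (induction "length p" arbitrary: u p rule: less_induct)
  case less
  from less.prems have "p \<noteq> []"
    by auto
  show ?case
  proof (cases "distinct (tl (awalk_verts u p))")
    case True
    with less.prems \<open>p \<noteq> []\<close> show ?thesis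
      unfolding cycle_def by auto
  next
    case False
    obtain e es where p: "p = e # es"
      using \<open>p \<noteq> []\<close> by (cases p) auto
    with False less.prems have *: "e \<in> parcs G" "u = fst e" "awalk (snd e) es u"
      "\<not> distinct (awalk_verts (snd e) es)"
      by (auto simp: awalk_Cons_iff)
    obtain q r s w where qrs: "es = q @ r @ s" "r \<noteq> []"
      "awalk (snd e) q w" "awalk w r w" "awalk w s u"
      using awalk_not_distinct_decomp[OF *(3,4)] by auto
    show ?thesis
    proof (cases "odd (length r)")
      case True
      have "length r < length p"
        using p qrs(1) by simp
      with less.hyps[OF _ qrs(4) True] show ?thesis
        by (meson less_imp_le order_trans)
    next
      case False
      have "awalk (snd e) (q @ s) u"
        using qrs(3,5) by (rule awalk_appendI)
      then have closed: "awalk u (e # q @ s) u"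
        using * by (simp add: awalk_Cons_iff del: awalk_append_iff)
      have odd: "odd (length (e # q @ s))"
        using False less.prems(2) p qrs(1) by simp
      have shorter: "length (e # q @ s) < length p"
        using p qrs(1,2) by simp
      obtain q' where "cycle q'" "odd (length q')" "length q' \<le> length (e # q @ s)"
        using less.hyps[OF shorter closed odd] by blast
      then show ?thesis
        using shorter by (intro exI[of _ q']) linarith
    qed
  qed
qed

text \<open>A cycle is itself a closed walk; conversely, an odd closed walk yields an odd cycle that
  is no longer.\<close>

lemma no_short_odd_cycle_iff: "no_short_odd_cycle k G \<longleftrightarrow> odd_walk_free k (parcs G)"
proof
  assume no: "no_short_odd_cycle k G"
  show "odd_walk_free k (parcs G)"
    unfolding odd_walk_free_def
  proof (intro allI impI notI)
    fix l u assume l: "odd l \<and> l \<le> 2 * k - 1" and u: "(u, u) \<in> parcs G ^^ l"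
    \<comment> \<open>A walk of length 0 exists even outside the vertex set; odd length forces an
      arc leaving \<open>u\<close>, so \<open>u\<close> is a vertex.\<close>
    then obtain m where "l = Suc m"
      by (cases l) auto
    then have "u \<in> pverts G"
      using relpow_Suc_D2 u wellformed'(1) by metis
    with u obtain p where "awalk u p u" "length p = l"
      using relpow_imp_awalk by blast
    then obtain q where "cycle q" "odd (length q)" "length q \<le> l"
      using odd_closed_walk_imp_cycle l by blast
    then show False
      using no l unfolding no_short_odd_cycle_def by force
  qed
next
  assume no: "odd_walk_free k (parcs G)"
  show "no_short_odd_cycle k G"
    unfolding no_short_odd_cycle_def cycle_def
    using no awalk_imp_relpow unfolding odd_walk_free_def by blast
qed

end

section \<open>Shift graphs\<close>

text \<open>The shift graph: an arc joins the two consecutive windows of length \<open>k\<close> in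
  an increasing sequence of \<open>k + 1\<close> elements. The orientation is kept to tell forward
  from backward steps.\<close>

definition shift :: "nat \<Rightarrow> 'a::linorder set rel" where
  "shift k = {(S - {Max S}, S - {Min S}) | S. finite S \<and> card S = Suc k}"

text \<open>For \<open>m\<close> in \<open>A\<close> this is the position of \<open>m\<close> in
  increasing order, counted from 0.\<close>

definition rank :: "'a::linorder \<Rightarrow> 'a set \<Rightarrow> nat" where
  "rank m A = card {x \<in> A. x < m}"

lemma shiftE:
  assumes "(A, B) \<in> shift k" "k \<ge> 1"
  obtains S a b where "finite S" "card S = Suc k" "a \<in> S" "b \<in> S" "a < b"
    "\<And>x. x \<in> S \<Longrightarrow> a \<le> x" "\<And>x. x \<in> S \<Longrightarrow> x \<le> b" "A = S - {b}" "B = S - {a}"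
proof -
  obtain S where S: "finite S" "card S = Suc k" "A = S - {Max S}" "B = S - {Min S}"
    using assms by (auto simp: shift_def)
  have ne: "S \<noteq> {}"
    using S by auto
  have "Min S \<noteq> Max S"
  proof
    assume eq: "Min S = Max S"
    have "S \<subseteq> {Max S}"
    proof
      fix x assume "x \<in> S"
      then have "Min S \<le> x" "x \<le> Max S"
        using S(1) by auto
      then show "x \<in> {Max S}"
        using eq by auto
    qed
    then have "card S \<le> card {Max S}"
      by (intro card_mono) auto
    then show False
      using S(2) assms(2) by simp
  qed
  moreover have "Min S \<le> Max S"
    using S(1) ne by auto
  ultimately have "Min S < Max S"
    by auto
  then show ?thesis
    using that[of S "Min S" "Max S"] S ne by auto
qed

lemma shift_card:
  assumes "(A, B) \<in> shift k" "k \<ge> 1"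
  shows "finite A" "finite B" "card A = k" "card B = k"
  using assms by (auto elim!: shiftE)

text \<open>A shared element lies strictly between the minimum and the maximum of the underlying
  \<open>k + 1\<close> elements, and of those below it only the minimum disappears.\<close>

lemma rank_shift:
  assumes "(A, B) \<in> shift k" "k \<ge> 1" "m \<in> A" "m \<in> B"
  shows "rank m A = Suc (rank m B)"
proof -
  obtain S a b where S: "finite S" "a \<in> S" "b \<in> S" "a < b"
    "\<And>x. x \<in> S \<Longrightarrow> a \<le> x" "\<And>x. x \<in> S \<Longrightarrow> x \<le> b" "A = S - {b}" "B = S - {a}"
    using shiftE[OF assms(1,2)] by metis
  have "a < m" "m < b"
    using S(5,6)[of m] S(7,8) assms(3,4) by auto
  then have "{x \<in> A. x < m} = insert a {x \<in> B. x < m}"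
    using S(2-8) by auto
  then show ?thesis
    using S(1,8) by (simp add: rank_def)
qed

text \<open>The only element lost from \<open>A\<close> to \<open>B\<close> is the least
  one.\<close>

lemma shift_lost_forward:
  assumes "(A, B) \<in> shift k" "k \<ge> 1" "m \<in> A" "m \<notin> B"
  shows "rank m A = 0" "m < Min B"
proof -
  obtain S a b where S: "finite S" "a \<in> S" "b \<in> S" "a < b"
    "\<And>x. x \<in> S \<Longrightarrow> a \<le> x" "\<And>x. x \<in> S \<Longrightarrow> x \<le> b" "A = S - {b}" "B = S - {a}"
    using shiftE[OF assms(1,2)] by metis
  have m: "m = a"
    using S assms by auto
  then have "{x \<in> A. x < m} = {}"
    using S(5,7) leD by auto
  then show "rank m A = 0"
    by (simp only: rank_def card.empty)
  have "Min B \<in> B"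
    using S by (intro Min_in) auto
  then show "m < Min B"
    using S(5)[of "Min B"] S(8) m by auto
qed

text \<open>Read backwards, from \<open>B\<close> to \<open>A\<close>, the only element lost is the
  greatest one.\<close>

lemma shift_lost_backward:
  assumes "(A, B) \<in> shift k" "k \<ge> 1" "m \<in> B" "m \<notin> A"
  shows "Suc (rank m B) = k" "Max A < m"
proof -
  obtain S a b where S: "finite S" "card S = Suc k" "a \<in> S" "b \<in> S" "a < b"
    "\<And>x. x \<in> S \<Longrightarrow> a \<le> x" "\<And>x. x \<in> S \<Longrightarrow> x \<le> b" "A = S - {b}" "B = S - {a}"
    using shiftE[OF assms(1,2)] by metis
  have m: "m = b"
    using S assms by auto
  then have "insert m {x \<in> B. x < m} = B"
    using S(7,9) assms(3) by fastforce
  then have "card (insert m {x \<in> B. x < m}) = k"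
    using shift_card(4)[OF assms(1,2)] by simp
  then show "Suc (rank m B) = k"
    using S(1,9) by (simp add: rank_def)
  have "Max A \<in> A"
    using S by (intro Max_in) auto
  then show "Max A < m"
    using S(7)[of "Max A"] S(8) m by auto
qed

section \<open>Closed walks in shift graphs\<close>

definition forward_steps :: "nat \<Rightarrow> (nat \<Rightarrow> 'a::linorder set) \<Rightarrow> nat \<Rightarrow> nat" where
  "forward_steps k w j = (\<Sum>i<j. if (w i, w (Suc i)) \<in> shift k then 1 else 0)"

text \<open>Every step that is not a forward arc counts as backward, so the two counts always add up
  to \<open>j\<close>.\<close>

definition backward_steps :: "nat \<Rightarrow> (nat \<Rightarrow> 'a::linorder set) \<Rightarrow> nat \<Rightarrow> nat" where
  "backward_steps k w j = (\<Sum>i<j. if (w i, w (Suc i)) \<in> shift k then 0 else 1)"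

lemma steps_add: "forward_steps k w j + backward_steps k w j = j"
  unfolding forward_steps_def backward_steps_def by (induction j) auto

text \<open>The rank of an element that is never lost drops by one on forward steps and grows by one on
  backward steps, so it can only return to its initial value after an even number of steps.\<close>

lemma surviving_element_imp_even:
  fixes w :: "nat \<Rightarrow> 'a::linorder set"
  assumes k: "k \<ge> 1"
    and steps: "\<And>i. i < l \<Longrightarrow> (w i, w (Suc i)) \<in> shift k \<union> (shift k)\<inverse>"
    and closed: "w l = w 0" and m: "m \<in> w 0"
    and survive: "\<And>i. \<lbrakk>i < l; m \<in> w i;
        rank m (w i) + forward_steps k w i = rank m (w 0) + backward_steps k w i\<rbrakk>
        \<Longrightarrow> m \<in> w (Suc i)"
  shows "even l"
proof -
  have "m \<in> w j \<and> rank m (w j) + forward_steps k w j = rank m (w 0) + backward_steps k w j"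
    if "j \<le> l" for j
    using that
  proof (induction j)
    case 0
    then show ?case
      using m by (simp add: forward_steps_def backward_steps_def)
  next
    case (Suc j)
    then have IH: "m \<in> w j"
      "rank m (w j) + forward_steps k w j = rank m (w 0) + backward_steps k w j"
      and j: "j < l"
      by auto
    have m': "m \<in> w (Suc j)"
      using survive[OF j IH] .
    show ?case
    proof (cases "(w j, w (Suc j)) \<in> shift k")
      case True
      with rank_shift[OF True k IH(1) m'] IH m' show ?thesis
        by (simp add: forward_steps_def backward_steps_def)
    next
      case False
      then have "(w (Suc j), w j) \<in> shift k"
        using steps[OF j] by auto
      from rank_shift[OF this k m' IH(1)] IH m' False show ?thesis
        by (simp add: forward_steps_def backward_steps_def)
    qed
  qed
  from this[of l] have "forward_steps k w l = backward_steps k w l"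
    using closed by simp
  then show ?thesis
    using steps_add[of k w l] by (metis even_add)
qed

text \<open>Moving the window by one trades \<open>g s\<close> for the equal
  \<open>g (s + l)\<close>. This lets a closed walk start at any of its vertices with unchanged step
  counts.\<close>

lemma sum_periodic:
  fixes g :: "nat \<Rightarrow> nat"
  assumes "\<And>i. g (i + l) = g i"
  shows "(\<Sum>i<l. g (s + i)) = (\<Sum>i<l. g i)"
proof (induction s)
  case (Suc s)
  have "(\<Sum>i<Suc l. g (s + i)) = g s + (\<Sum>i<l. g (Suc s + i))"
    by (subst sum.lessThan_Suc_shift) simp
  moreover have "(\<Sum>i<Suc l. g (s + i)) = (\<Sum>i<l. g (s + i)) + g s"
    using assms[of s] by simp
  ultimately show ?case
    using Suc by simp
qed simp

text \<open>If there are fewer than \<open>k\<close> backward steps, the largest minimum occurring on the walk is never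
  lost; if there are fewer than \<open>k\<close> forward steps, the smallest maximum is never lost.\<close>

lemma shift_periodic_walk_even:
  fixes w :: "nat \<Rightarrow> 'a::linorder set"
  assumes k: "k \<ge> 1"
    and steps: "\<And>i. (w i, w (Suc i)) \<in> shift k \<union> (shift k)\<inverse>"
    and periodic: "\<And>i. w (i + l) = w i" and l: "0 < l" "l \<le> 2 * k - 1"
  shows "even l"
proof -
  have fin: "finite (w i)" "card (w i) = k" for i
    using steps[of i] shift_card[OF _ k] by auto
  then have ne: "w i \<noteq> {}" for i
    using k fin(2)[of i] by (metis card.empty not_one_le_zero)
  have periodic': "w (s * l + i) = w i" for s i
  proof (induction s)
    case (Suc s)
    have "w (Suc s * l + i) = w ((s * l + i) + l)"
      by (simp add: algebra_simps)
    then show ?case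
      using periodic[of "s * l + i"] Suc by simp
  qed simp
  have w_mod: "w i = w (i mod l)" for i
    using periodic'[of "i div l" "i mod l"] by simp
  have fw: "forward_steps k (\<lambda>i. w (s + i)) l = forward_steps k w l" for s
    using sum_periodic[of "\<lambda>i. if (w i, w (Suc i)) \<in> shift k then 1 else 0" l s]
      periodic periodic[of "Suc _"] by (simp add: forward_steps_def)
  have bw: "backward_steps k (\<lambda>i. w (s + i)) l = backward_steps k w l" for s
    using steps_add[of k "\<lambda>i. w (s + i)" l] steps_add[of k w l] fw[of s] by simp
  have mono: "forward_steps k v i \<le> forward_steps k v j"
      "backward_steps k v i \<le> backward_steps k v j" if "i \<le> j" for i j and v :: "nat \<Rightarrow> 'a set"
    using that by (auto simp: forward_steps_def backward_steps_def intro!: sum_mono2)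
  \<comment> \<open>At most \<open>2 * k - 1\<close> steps cannot contain \<open>k\<close> in each
    direction.\<close>
  consider "backward_steps k w l < k" | "forward_steps k w l < k"
    using steps_add[of k w l] l by linarith
  then show ?thesis
  proof cases
    case 1
    define m where "m = Max ((\<lambda>i. Min (w i)) ` {..<l})"
    have "m \<in> (\<lambda>i. Min (w i)) ` {..<l}"
      unfolding m_def using l by (intro Max_in) auto
    then obtain s where s: "m = Min (w s)"
      by auto
    have le: "Min (w i) \<le> m" for i
      unfolding m_def using l by (subst w_mod) (intro Max_ge, auto)
    have ms: "m \<in> w s"
      using s fin ne by simp
    have "{x \<in> w s. x < m} = {}"
      using s fin by (auto simp: not_less)
    then have r0: "rank m (w s) = 0"
      by (simp only: rank_def card.empty)
    show ?thesis
    proof (rule surviving_element_imp_even[OF k, of l "\<lambda>i. w (s + i)" m])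
      fix i assume i: "i < l" "m \<in> w (s + i)" and
        eq: "rank m (w (s + i)) + forward_steps k (\<lambda>i. w (s + i)) i
          = rank m (w (s + 0)) + backward_steps k (\<lambda>i. w (s + i)) i"
      show "m \<in> w (s + Suc i)"
      proof (rule ccontr)
        assume lost: "m \<notin> w (s + Suc i)"
        show False
        proof (cases "(w (s + i), w (s + Suc i)) \<in> shift k")
          case True
          \<comment> \<open>The next set would have a minimum above the largest minimum.\<close>
          from shift_lost_forward(2)[OF True k i(2) lost] le[of "s + Suc i"] show False
            by simp
        next
          case False
          then have "(w (s + Suc i), w (s + i)) \<in> shift k"
            using steps[of "s + i"] by auto
          \<comment> \<open>The rank starts at 0, so reaching \<open>k - 1\<close> takes at least
            \<open>k - 1\<close> backward steps, and the losing step is one more.\<close>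
          from shift_lost_backward(1)[OF this k i(2) lost]
          have "k \<le> Suc (backward_steps k (\<lambda>i. w (s + i)) i)"
            using eq r0 by simp
          also have "\<dots> = backward_steps k (\<lambda>i. w (s + i)) (Suc i)"
            using False by (simp add: backward_steps_def)
          also have "\<dots> \<le> backward_steps k (\<lambda>i. w (s + i)) l"
            using i(1) by (intro mono) simp
          finally show False
            using 1 bw[of s] by simp
        qed
      qed
    qed (use steps periodic ms in auto)
  next
    case 2
    define m where "m = Min ((\<lambda>i. Max (w i)) ` {..<l})"
    have "m \<in> (\<lambda>i. Max (w i)) ` {..<l}"
      unfolding m_def using l by (intro Min_in) auto
    then obtain s where s: "m = Max (w s)"
      by auto
    have le: "m \<le> Max (w i)" for i
      unfolding m_def using l by (subst w_mod) (intro Min_le, auto)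
    have ms: "m \<in> w s"
      using s fin ne by simp
    have "insert m {x \<in> w s. x < m} = w s"
      using ms s fin Max_ge[of "w s"] by (auto simp: order.strict_iff_order)
    then have "card (insert m {x \<in> w s. x < m}) = k"
      using fin by simp
    then have r0: "Suc (rank m (w s)) = k"
      using fin by (simp add: rank_def)
    show ?thesis
    proof (rule surviving_element_imp_even[OF k, of l "\<lambda>i. w (s + i)" m])
      fix i assume i: "i < l" "m \<in> w (s + i)" and
        eq: "rank m (w (s + i)) + forward_steps k (\<lambda>i. w (s + i)) i
          = rank m (w (s + 0)) + backward_steps k (\<lambda>i. w (s + i)) i"
      show "m \<in> w (s + Suc i)"
      proof (rule ccontr)
        assume lost: "m \<notin> w (s + Suc i)"
        show False
        proof (cases "(w (s + i), w (s + Suc i)) \<in> shift k")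
          case True
          \<comment> \<open>Dually, the rank starts at \<open>k - 1\<close> and must fall to 0
            before a forward step can lose \<open>m\<close>.\<close>
          from shift_lost_forward(1)[OF True k i(2) lost]
          have "k \<le> Suc (forward_steps k (\<lambda>i. w (s + i)) i)"
            using eq r0 by simp
          also have "\<dots> = forward_steps k (\<lambda>i. w (s + i)) (Suc i)"
            using True by (simp add: forward_steps_def)
          also have "\<dots> \<le> forward_steps k (\<lambda>i. w (s + i)) l"
            using i(1) by (intro mono) simp
          finally show False
            using 2 fw[of s] by simp
        next
          case False
          then have "(w (s + Suc i), w (s + i)) \<in> shift k"
            using steps[of "s + i"] by auto
          from shift_lost_backward(2)[OF this k i(2) lost] le[of "s + Suc i"] show False
            by simp
        qed
      qed
    qed (use steps periodic ms in auto)
  qed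
qed

lemma odd_walk_free_shift:
  assumes k: "k \<ge> 1"
  shows "odd_walk_free k (shift k \<union> (shift k)\<inverse> :: 'a::linorder set rel)" (is "odd_walk_free k ?R")
  unfolding odd_walk_free_def
proof (intro allI impI notI)
  fix l and u :: "'a set"
  assume l: "odd l \<and> l \<le> 2 * k - 1" and "(u, u) \<in> ?R ^^ l"
  then obtain f where f: "f 0 = u" "f l = u" "\<And>i. i < l \<Longrightarrow> (f i, f (Suc i)) \<in> ?R"
    by (auto simp only: relpow_fun_conv)
  have "l > 0"
    using l by (intro Nat.gr0I) auto
  \<comment> \<open>The closed walk is repeated periodically; at the end of a period the index wraps
    to 0, where \<open>f\<close> agrees with \<open>f l\<close>.\<close>
  have "(f (i mod l), f (Suc i mod l)) \<in> ?R" for i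
  proof -
    have "f (Suc i mod l) = f (Suc (i mod l))"
      using f(1,2) by (simp add: mod_Suc)
    then show ?thesis
      using f(3)[of "i mod l"] \<open>l > 0\<close> by simp
  qed
  then have "even l"
    using shift_periodic_walk_even[OF k, of "\<lambda>i. f (i mod l)" l] \<open>l > 0\<close> l by simp
  then show False
    using l by simp
qed

text \<open>By Ramsey's theorem, any \<open>n\<close>-colouring of the \<open>k\<close>-subsets of a
  large interval is constant on the \<open>k\<close>-subsets of some set \<open>H\<close> of size
  \<open>k + 1\<close>. Two of these, \<open>H\<close> without its maximum and \<open>H\<close>
  without its minimum, are adjacent.\<close>

lemma exists_non_colorable:
  assumes k: "k \<ge> 1"
  shows "\<exists>G :: nat pair_pre_digraph. pair_graph G \<and> no_short_odd_cycle k G \<and> \<not> colorable n G"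
proof -
  obtain N :: nat where N: "partn_lst {..<N} (replicate n (Suc k)) k"
    using ramsey_full by blast
  define R :: "nat set rel" where "R = shift k \<union> (shift k)\<inverse>"
  \<comment> \<open>Sets are encoded as numbers because vertices have type
    \<open>nat\<close>.\<close>
  define V where "V = {u. set_decode u \<in> nsets {..<N} k}"
  define G where "G = \<lparr>pverts = V, parcs = {(u, v). (set_decode u, set_decode v) \<in> R \<and> u \<in> V \<and> v \<in> V}\<rparr>"
  have free: "odd_walk_free k (parcs G)"
    unfolding odd_walk_free_def
  proof (intro allI impI notI)
    fix l u assume l: "odd l \<and> l \<le> 2 * k - 1" and "(u, u) \<in> parcs G ^^ l"
    then have "(set_decode u, set_decode u) \<in> R ^^ l"
      by (elim relpow_map) (auto simp: G_def)
    then show False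
      using odd_walk_free_shift[OF k, where 'a = nat] l unfolding R_def odd_walk_free_def by blast
  qed
  have "V \<subseteq> set_encode ` nsets {..<N} k"
    unfolding V_def by (metis (mono_tags, lifting) image_eqI mem_Collect_eq set_decode_inverse subsetI)
  then have finV: "finite V"
    using finite_imp_finite_nsets[of "{..<N}" k] finite_surj by blast
  have finA: "finite (parcs G)"
    by (rule finite_subset[of _ "V \<times> V"]) (auto simp: G_def finV)
  \<comment> \<open>A loop would be an odd closed walk of length 1.\<close>
  have loops: "(u, u) \<notin> parcs G" for u
    using free[unfolded odd_walk_free_def, rule_format, of 1 u] k by simp
  have "sym (parcs G)"
    by (auto simp: G_def R_def sym_def)
  then have "symmetric (with_proj G)"
    by (simp add: symmetric_def)
  then interpret pair_graph G
    using finV finA loops by unfold_locales (auto simp: G_def)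
  have "\<not> colorable n G"
  proof
    assume "colorable n G"
    then obtain c where c: "c ` V \<subseteq> {..<n}" "\<And>u v. (u, v) \<in> parcs G \<Longrightarrow> c u \<noteq> c v"
      unfolding colorable_def by (auto simp: G_def)
    have enc: "set_decode (set_encode A) = A" "set_encode A \<in> V" if "A \<in> nsets {..<N} k" for A
      using that by (auto simp: V_def nsets_def)
    have "c \<circ> set_encode \<in> nsets {..<N} k \<rightarrow> {..<n}"
      using c(1) enc(2) by (force simp: image_subset_iff)
    then obtain i H where H: "i < n" "H \<in> nsets {..<N} (Suc k)"
      "(c \<circ> set_encode) ` nsets H k \<subseteq> {i}"
      by (rule partn_lstE[OF N]) auto
    have "finite H" "card H = Suc k" "H \<subseteq> {..<N}"
      using H(2) by (auto simp: nsets_def)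
    then have "H \<noteq> {}"
      by auto
    then have sub: "H - {Max H} \<in> nsets H k" "H - {Min H} \<in> nsets H k"
      using \<open>finite H\<close> \<open>card H = Suc k\<close> by (auto simp: nsets_def)
    then have sub': "H - {Max H} \<in> nsets {..<N} k" "H - {Min H} \<in> nsets {..<N} k"
      using nsets_mono[OF \<open>H \<subseteq> {..<N}\<close>] by auto
    have "(H - {Max H}, H - {Min H}) \<in> R"
      using \<open>finite H\<close> \<open>card H = Suc k\<close> by (auto simp: R_def shift_def)
    then have "(set_encode (H - {Max H}), set_encode (H - {Min H})) \<in> parcs G"
      using sub'[THEN enc(1)] sub'[THEN enc(2)] by (simp add: G_def)
    then have "c (set_encode (H - {Max H})) \<noteq> c (set_encode (H - {Min H}))"
      by (rule c(2))
    moreover have "c (set_encode (H - {Max H})) = i" "c (set_encode (H - {Min H})) = i"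
      using H(3) sub by (auto simp: image_subset_iff)
    ultimately show False
      by simp
  qed
  then show ?thesis
    using free no_short_odd_cycle_iff pair_graph_axioms by blast
qed

section \<open>The extremal function\<close>

text \<open>The size of a single non-\<open>n\<close>-colourable graph is a bound; this gives
  \<open>GREATEST\<close> in \<open>max_colorable\<close> its meaning.\<close>

lemma all_colorable_upto_bounded:
  assumes "k \<ge> 1"
  shows "\<exists>b. \<forall>m. all_colorable_upto n k m \<longrightarrow> m \<le> b"
proof -
  obtain G :: "nat pair_pre_digraph" where "pair_graph G" "no_short_odd_cycle k G" "\<not> colorable n G"
    using exists_non_colorable[OF assms] by blast
  then have "m \<le> card (pverts G)" if "all_colorable_upto n k m" for m
    using that unfolding all_colorable_upto_def by (meson nat_le_linear)
  then show ?thesis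
    by blast
qed

lemma colorable_if_le_max_colorable:
  fixes G :: "nat pair_pre_digraph"
  assumes "k \<ge> 1" "pair_graph G" "no_short_odd_cycle k G" "card (pverts G) \<le> max_colorable n k"
  shows "colorable n G"
proof -
  \<comment> \<open>The greatest value is attained only if some value is admissible; 0 is, by the
    empty graph.\<close>
  have "all_colorable_upto n k 0"
    unfolding all_colorable_upto_def
  proof (intro allI impI)
    fix H :: "nat pair_pre_digraph"
    assume H: "pair_graph H \<and> no_short_odd_cycle k H \<and> card (pverts H) \<le> 0"
    then interpret pair_graph H
      by simp
    have "pverts H = {}"
      using H pair_finite_verts by simp
    then show "colorable n H"
      unfolding colorable_def using wellformed' by auto
  qed
  then have "all_colorable_upto n k (max_colorable n k)"
    unfolding max_colorable_def using all_colorable_upto_bounded[OF assms(1), of n]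
    by (metis GreatestI_nat)
  then show ?thesis
    using assms(2-4) unfolding all_colorable_upto_def by blast
qed

text \<open>Failure at \<open>Suc (max_colorable n k)\<close> gives a counterexample of at most that
  size, and a smaller one would be colourable.\<close>

lemma obtain_minimal_non_colorable:
  assumes "k \<ge> 1"
  obtains G :: "nat pair_pre_digraph" where "pair_graph G" "no_short_odd_cycle k G"
    "\<not> colorable n G" "card (pverts G) = Suc (max_colorable n k)"
proof -
  have "\<not> all_colorable_upto n k (Suc (max_colorable n k))"
    unfolding max_colorable_def using all_colorable_upto_bounded[OF assms, of n]
    by (metis Greatest_le_nat Suc_n_not_le_n)
  then obtain G :: "nat pair_pre_digraph" where G: "pair_graph G" "no_short_odd_cycle k G"
    "\<not> colorable n G" "card (pverts G) \<le> Suc (max_colorable n k)"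
    unfolding all_colorable_upto_def by blast
  moreover have "\<not> card (pverts G) \<le> max_colorable n k"
    using G colorable_if_le_max_colorable[OF assms] by blast
  ultimately show ?thesis
    using that by simp
qed

section \<open>Induced subgraphs\<close>

definition induced :: "'a pair_pre_digraph \<Rightarrow> 'a set \<Rightarrow> 'a pair_pre_digraph" where
  "induced G W = \<lparr>pverts = W, parcs = Restr (parcs G) W\<rparr>"

lemma induced_simps [simp]:
  "pverts (induced G W) = W" "parcs (induced G W) = Restr (parcs G) W"
  by (simp_all add: induced_def)

lemma colorable_inducedE:
  assumes "colorable n (induced G W)"
  obtains c :: "'a \<Rightarrow> nat" where "\<And>w. w \<in> W \<Longrightarrow> c w < n"
    "\<And>u v. (u, v) \<in> parcs G \<Longrightarrow> u \<in> W \<Longrightarrow> v \<in> W \<Longrightarrow> c u \<noteq> c v"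
  using assms unfolding colorable_def by fastforce

lemma (in pair_graph) sym_parcs: "sym (parcs G)"
  using pair_sym_arcs by (simp add: symmetric_def)

lemma (in pair_graph) pair_graph_induced:
  assumes "W \<subseteq> pverts G"
  shows "pair_graph (induced G W)"
proof -
  have "symmetric (with_proj (induced G W))"
    using sym_parcs by (auto simp: symmetric_def sym_def)
  then show ?thesis
    using assms pair_finite_verts pair_finite_arcs pair_no_loops
    by unfold_locales (auto intro: finite_subset)
qed

text \<open>Deleting vertices creates no odd closed walks. The contrapositive bounds the size of
  non-colourable induced subgraphs from below.\<close>

lemma colorable_induced:
  fixes G :: "nat pair_pre_digraph"
  assumes "k \<ge> 1" "pair_graph G" "no_short_odd_cycle k G" "W \<subseteq> pverts G"
    "card W \<le> max_colorable n k"
  shows "colorable n (induced G W)"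
proof -
  interpret G: pair_graph G
    by fact
  interpret I: pair_graph "induced G W"
    using assms(4) by (rule G.pair_graph_induced)
  have "no_short_odd_cycle k (induced G W)"
    using assms(3) G.no_short_odd_cycle_iff I.no_short_odd_cycle_iff
      odd_walk_free_mono[of k "parcs G" "Restr (parcs G) W"] by simp
  then show ?thesis
    using colorable_if_le_max_colorable[OF assms(1) I.pair_graph_axioms] assms(5) by simp
qed

section \<open>Balls\<close>

definition ball :: "'a rel \<Rightarrow> 'a \<Rightarrow> nat \<Rightarrow> 'a set" where
  "ball R v i = {w. \<exists>j\<le>i. (v, w) \<in> R ^^ j}"

text \<open>Meaningful only for \<open>w\<close> reachable from \<open>v\<close>; it is evaluated
  only inside balls.\<close>

definition distance :: "'a rel \<Rightarrow> 'a \<Rightarrow> 'a \<Rightarrow> nat" where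
  "distance R v w = (LEAST j. (v, w) \<in> R ^^ j)"

lemma ball_0 [simp]: "ball R v 0 = {v}"
  by (auto simp: ball_def)

lemma center_in_ball: "v \<in> ball R v i"
  by (auto simp: ball_def intro!: exI[of _ 0])

lemma ball_mono: "i \<le> j \<Longrightarrow> ball R v i \<subseteq> ball R v j"
  unfolding ball_def by (blast intro: order_trans)

lemma ball_mono_rel: "R \<subseteq> S \<Longrightarrow> ball R v i \<subseteq> ball S v i"
  using relpow_subset[of R S] by (auto simp: ball_def)

lemma ball_subset:
  assumes "R \<subseteq> W \<times> W" "v \<in> W"
  shows "ball R v i \<subseteq> W"
proof
  fix w assume "w \<in> ball R v i"
  then obtain j where "(v, w) \<in> R ^^ j"
    by (auto simp: ball_def)
  then show "w \<in> W"
    using assms by (cases j) auto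
qed

lemma ball_step:
  assumes "x \<in> ball R v i" "(x, y) \<in> R"
  shows "y \<in> ball R v (Suc i)"
proof -
  obtain j where "j \<le> i" "(v, x) \<in> R ^^ j"
    using assms(1) by (auto simp: ball_def)
  with assms(2) have "Suc j \<le> Suc i" "(v, y) \<in> R ^^ Suc j"
    by auto
  then show ?thesis
    unfolding ball_def by blast
qed

lemma distance_relpow:
  assumes "w \<in> ball R v i"
  shows "(v, w) \<in> R ^^ distance R v w" "distance R v w \<le> i"
proof -
  obtain j where j: "j \<le> i" "(v, w) \<in> R ^^ j"
    using assms by (auto simp: ball_def)
  show "(v, w) \<in> R ^^ distance R v w"
    unfolding distance_def using j(2) by (rule LeastI)
  have "distance R v w \<le> j"
    unfolding distance_def using j(2) by (rule Least_le)
  then show "distance R v w \<le> i"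
    using j(1) by simp
qed

text \<open>From a smaller distance, one more step would still end inside the ball.\<close>

lemma distance_boundary:
  assumes "x \<in> ball R v i" "(x, y) \<in> R" "y \<notin> ball R v i"
  shows "distance R v x = i"
proof (rule ccontr)
  assume "distance R v x \<noteq> i"
  with distance_relpow[OF assms(1)] have "Suc (distance R v x) \<le> i"
    "(v, y) \<in> R ^^ Suc (distance R v x)"
    using assms(2) by auto
  then show False
    using assms(3) unfolding ball_def by blast
qed

text \<open>Shortest walks from \<open>v\<close> to \<open>x\<close> and \<open>y\<close> close up
  with the edge to a walk of length at most \<open>2 * (k - 1) + 1 = 2 * k - 1\<close>, which must
  therefore be even.\<close>

lemma distance_parity:
  assumes "sym R" "odd_walk_free k R" "k \<ge> 1" "i \<le> k - 1"
    and "x \<in> ball R v i" "y \<in> ball R v i" "(x, y) \<in> R"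
  shows "even (distance R v x) \<noteq> even (distance R v y)"
proof -
  let ?l = "Suc (distance R v x) + distance R v y"
  note x = distance_relpow[OF assms(5)] and y = distance_relpow[OF assms(6)]
  have "(v, y) \<in> R ^^ Suc (distance R v x)"
    using x(1) assms(7) by auto
  moreover have "(y, v) \<in> R ^^ distance R v y"
    using y(1) sym_relpow[OF assms(1)] by (auto dest: symD)
  ultimately have "(v, v) \<in> R ^^ ?l"
    unfolding relpow_add by auto
  moreover have "?l \<le> 2 * k - 1"
    using x(2) y(2) assms(3,4) by linarith
  ultimately have "even ?l"
    using assms(2) unfolding odd_walk_free_def by blast
  then show ?thesis
    by auto
qed

text \<open>Only the outermost level of the ball has neighbours outside; giving it the colour \<open>a\<close> and
  alternating \<open>a\<close> and \<open>b\<close> towards the centre extends a colouring of the complement.\<close>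

lemma extend_coloring_over_ball:
  assumes "sym R" "odd_walk_free k R" "k \<ge> 1" "i \<le> k - 1"
    and c: "\<And>x y. (x, y) \<in> R \<Longrightarrow> x \<notin> ball R v i \<Longrightarrow> y \<notin> ball R v i \<Longrightarrow> c x \<noteq> c y"
    and a: "a \<notin> c ` (ball R v (Suc i) - ball R v i)" and "a \<noteq> b"
    and c': "c' = (\<lambda>w. if w \<in> ball R v i then if even (distance R v w) = even i then a else b else c w)"
    and "(x, y) \<in> R"
  shows "c' x \<noteq> c' y"
proof -
  \<comment> \<open>The outer endpoint lies on the next level, where \<open>c\<close> avoids
    \<open>a\<close>; the inner one is at distance \<open>i\<close> and has colour
    \<open>a\<close>.\<close>
  have one_in: "c' p \<noteq> c' q" if "p \<in> ball R v i" "q \<notin> ball R v i" "(p, q) \<in> R" for p q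
  proof -
    have "q \<in> ball R v (Suc i) - ball R v i"
      using ball_step[OF that(1,3)] that(2) by blast
    then have "c q \<noteq> a"
      using a by blast
    then show ?thesis
      using that distance_boundary[OF that(1,3,2)] by (simp add: c')
  qed
  have "(y, x) \<in> R"
    using assms(1,9) by (auto dest: symD)
  show ?thesis
  proof (cases "x \<in> ball R v i")
    case True
    show ?thesis
    proof (cases "y \<in> ball R v i")
      case y: True
      show ?thesis
        using distance_parity[OF assms(1-4) True y \<open>(x, y) \<in> R\<close>] True y \<open>a \<noteq> b\<close> by (auto simp: c')
    next
      case False
      then show ?thesis
        using one_in True \<open>(x, y) \<in> R\<close> by blast
    qed
  next
    case False
    show ?thesis
    proof (cases "y \<in> ball R v i")
      case True
      then show ?thesis
        using one_in[OF True False \<open>(y, x) \<in> R\<close>] by simp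
    next
      case y: False
      then show ?thesis
        using c[OF \<open>(x, y) \<in> R\<close> False y] False by (simp add: c')
    qed
  qed
qed

section \<open>Large bipartite induced subgraphs\<close>

text \<open>Starting from any vertex, some ball grows by a factor at most \<open>r\<close> in its next step, since
  otherwise the ball of radius \<open>k - 1\<close> would be too large. Put the ball into \<open>X\<close>, delete its
  boundary, and repeat.\<close>

lemma large_bipartite_subset:
  fixes E :: "'a rel" and r :: real
  assumes "finite W" and E: "sym E" "odd_walk_free k E" and k2: "k \<ge> 2"
    and small: "\<And>v. v \<in> W \<Longrightarrow> finite (ball E v (k - 1)) \<and> real (card (ball E v (k - 1))) \<le> r ^ (k - 1)"
    and r: "r \<ge> 0"
  shows "\<exists>X\<subseteq>W. (\<exists>c :: 'a \<Rightarrow> nat. (\<forall>x. c x < 2) \<and> (\<forall>(x, y)\<in>Restr E X. c x \<noteq> c y))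
           \<and> real (card W) \<le> r * real (card X)"
  using assms(1) small
proof (induction W rule: finite_psubset_induct)
  case (psubset W)
  show ?case
  proof (cases "W = {}")
    case True
    then show ?thesis
      by (intro exI[of _ "{}"]) (auto intro: exI[of _ "\<lambda>_. 0"])
  next
    case False
    then obtain v where v: "v \<in> W"
      by blast
    have k: "k \<ge> 1"
      using k2 by simp
    \<comment> \<open>Balls are grown in what remains of the graph, whereas the size hypothesis
      concerns balls of \<open>E\<close> and so passes unchanged to smaller
      \<open>W\<close>.\<close>
    define R where "R = Restr E W"
    have R: "sym R" "odd_walk_free k R" "R \<subseteq> W \<times> W" "R \<subseteq> E"
      using E(1) odd_walk_free_mono[OF E(2), of R] by (auto simp: R_def sym_def)
    have sub: "ball R v i \<subseteq> W" for i
      using R(3) v by (rule ball_subset)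
    have fin: "finite (ball R v i)" for i
      using sub psubset.hyps(1) by (rule finite_subset)
    have "\<exists>i<k - 1. real (card (ball R v (Suc i))) \<le> r * real (card (ball R v i))"
    proof (rule ccontr)
      assume "\<not> ?thesis"
      then have grow: "r * real (card (ball R v i)) < real (card (ball R v (Suc i)))" if "i < k - 1" for i
        using that by force
      have pow: "r ^ i \<le> real (card (ball R v i))" if "i \<le> k - 1" for i
        using that
      proof (induction i)
        case (Suc i)
        then have "r ^ Suc i \<le> r * real (card (ball R v i))"
          using r by (simp add: mult_left_mono)
        then show ?case
          using grow[of i] Suc.prems by simp
      qed simp
      \<comment> \<open>The bound \<open>pow\<close> is weak, since it starts with equality at
        radius 0; splitting off the last step makes the inequality strict.\<close>
      have "r ^ (k - 1) = r * r ^ (k - 2)"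
        using k2 by (simp flip: power_Suc add: Suc_diff_Suc numeral_2_eq_2)
      also have "\<dots> \<le> r * real (card (ball R v (k - 2)))"
        using pow[of "k - 2"] r by (simp add: mult_left_mono)
      also have "\<dots> < real (card (ball R v (Suc (k - 2))))"
        using k2 by (intro grow) simp
      also have "Suc (k - 2) = k - 1"
        using k2 by simp
      also have "real (card (ball R v (k - 1))) \<le> real (card (ball E v (k - 1)))"
        using psubset.prems[OF v] ball_mono_rel[OF R(4)] by (simp add: card_mono)
      also have "\<dots> \<le> r ^ (k - 1)"
        using psubset.prems[OF v] by simp
      finally show False
        by simp
    qed
    then obtain i where i: "i < k - 1" "real (card (ball R v (Suc i))) \<le> r * real (card (ball R v i))"
      by blast
    define W' where "W' = W - ball R v (Suc i)"
    have "W' \<subset> W"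
      using v center_in_ball[of v R "Suc i"] by (auto simp: W'_def)
    then obtain X c where X: "X \<subseteq> W'" "\<forall>x. c x < (2::nat)" "\<forall>(x, y)\<in>Restr E X. c x \<noteq> c y"
      "real (card W') \<le> r * real (card X)"
      using psubset.IH[of W'] psubset.prems by blast
    have XW: "X \<subseteq> W"
      using X(1) by (auto simp: W'_def)
    have disj: "X \<inter> ball R v (Suc i) = {}"
      using X(1) by (auto simp: W'_def)
    then have disj': "X \<inter> ball R v i = {}"
      using ball_mono[of i "Suc i" R v] by auto
    \<comment> \<open>Parity of the distance colours the ball; no edge joins it to \<open>X\<close>,
      which avoids the next larger ball.\<close>
    define c' where "c' x = (if x \<in> ball R v i then if even (distance R v x) then 0 else 1 else c x)" for x
    have "c' x \<noteq> c' y" if xy: "(x, y) \<in> E" "x \<in> ball R v i \<union> X" "y \<in> ball R v i \<union> X" for x y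
    proof -
      have "(x, y) \<in> R" "(y, x) \<in> R"
        using xy sub[of i] XW R(1) by (auto simp: R_def dest: symD)
      show ?thesis
      proof (cases "x \<in> ball R v i")
        case True
        then have "y \<notin> X"
          using ball_step[OF True \<open>(x, y) \<in> R\<close>] disj by blast
        then have y: "y \<in> ball R v i"
          using xy by blast
        have "i \<le> k - 1"
          using i by simp
        from distance_parity[OF R(1,2) k this True y \<open>(x, y) \<in> R\<close>] True y show ?thesis
          by (simp add: c'_def)
      next
        case False
        then have "x \<in> X" "y \<notin> ball R v i"
          using xy ball_step[OF _ \<open>(y, x) \<in> R\<close>, of v i] disj by auto
        then show ?thesis
          using False xy X(3) by (auto simp: c'_def)
      qed
    qed
    then have "\<forall>(x, y)\<in>Restr E (ball R v i \<union> X). c' x \<noteq> c' y"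
      by auto
    moreover have "\<forall>x. c' x < 2"
      using X(2) by (simp add: c'_def)
    moreover have "ball R v i \<union> X \<subseteq> W"
      using sub XW by simp
    moreover have "real (card W) \<le> r * real (card (ball R v i \<union> X))"
    proof -
      \<comment> \<open>\<open>W\<close> loses the ball of radius \<open>Suc i\<close> while
        \<open>X\<close> gains the one of radius \<open>i\<close>, smaller by a factor of at most
        \<open>r\<close>.\<close>
      have "card W = card W' + card (ball R v (Suc i))"
        using card_Diff_subset[OF fin sub] card_mono[OF psubset.hyps(1) sub] by (simp add: W'_def)
      moreover have "card (ball R v i \<union> X) = card (ball R v i) + card X"
        using disj' fin finite_subset[OF XW psubset.hyps(1)] by (intro card_Un_disjoint) auto
      ultimately show ?thesis
        using X(4) i(2) by (simp add: algebra_simps)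
    qed
    ultimately show ?thesis
      by blast
  qed
qed

section \<open>The recursive bound\<close>

text \<open>A level with fewer than \<open>n\<close> vertices misses one of the \<open>n\<close>
  colours of the outside; that colour and any second one suffice for the ball.\<close>

lemma level_card_ge:
  fixes G :: "'a pair_pre_digraph"
  assumes "pair_graph G" "no_short_odd_cycle k G" "k \<ge> 1" "n \<ge> 2" "\<not> colorable n G"
    and crit: "\<And>W. W \<subset> pverts G \<Longrightarrow> colorable n (induced G W)"
    and v: "v \<in> pverts G" and i: "i \<le> k - 1"
  shows "n \<le> card (ball (parcs G) v (Suc i) - ball (parcs G) v i)"
proof (rule ccontr)
  interpret pair_graph G
    by fact
  let ?E = "parcs G" and ?V = "pverts G"
  let ?S = "ball ?E v (Suc i) - ball ?E v i"
  assume "\<not> ?thesis"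
  then have less: "card ?S < n"
    by simp
  have EV: "?E \<subseteq> ?V \<times> ?V"
    using wellformed' by auto
  have "?V - ball ?E v i \<subset> ?V"
    using v center_in_ball[of v ?E i] by auto
  then obtain c where c: "\<And>w. w \<in> ?V - ball ?E v i \<Longrightarrow> c w < n"
    "\<And>x y. (x, y) \<in> ?E \<Longrightarrow> x \<in> ?V - ball ?E v i \<Longrightarrow> y \<in> ?V - ball ?E v i \<Longrightarrow> c x \<noteq> c y"
    using colorable_inducedE[OF crit] by metis
  have "finite ?S"
    using ball_subset[OF EV v, of "Suc i"] pair_finite_verts by (meson finite_Diff finite_subset)
  then have "card (c ` ?S) < card {..<n}"
    using less card_image_le[of ?S c] by simp
  then have "\<not> {..<n} \<subseteq> c ` ?S"
    using \<open>finite ?S\<close> by (meson card_mono finite_imageI leD)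
  then obtain a where a: "a < n" "a \<notin> c ` ?S"
    by auto
  define b where "b = (if a = 0 then 1 else 0 :: nat)"
  have b: "b < n" "a \<noteq> b"
    using assms(4) by (auto simp: b_def)
  define c' where "c' = (\<lambda>w. if w \<in> ball ?E v i then
    if even (distance ?E v w) = even i then a else b else c w)"
  have "c' x \<noteq> c' y" if "(x, y) \<in> ?E" for x y
    using extend_coloring_over_ball[OF sym_parcs _ assms(3) i _ a(2) b(2) c'_def that]
      assms(2) no_short_odd_cycle_iff c(2) wellformed' by blast
  moreover have "c' ` ?V \<subseteq> {..<n}"
    using a b c(1) by (auto simp: c'_def)
  ultimately show False
    using assms(5) unfolding colorable_def by blast
qed

text \<open>The centre contributes 1 and each of the \<open>i\<close> levels around it at least
  \<open>n\<close>.\<close>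

lemma ball_card_ge:
  fixes G :: "'a pair_pre_digraph"
  assumes "pair_graph G" "no_short_odd_cycle k G" "k \<ge> 1" "n \<ge> 2" "\<not> colorable n G"
    and crit: "\<And>W. W \<subset> pverts G \<Longrightarrow> colorable n (induced G W)"
    and v: "v \<in> pverts G" and i: "i \<le> k - 1"
  shows "n * i + 1 \<le> card (ball (parcs G) v i)"
  using i
proof (induction i)
  case (Suc i)
  interpret pair_graph G
    by fact
  let ?E = "parcs G"
  have "?E \<subseteq> pverts G \<times> pverts G"
    using wellformed' by auto
  then have fin: "finite (ball ?E v j)" for j
    using ball_subset[of ?E "pverts G" v j] v pair_finite_verts by (simp add: finite_subset)
  have sub: "ball ?E v i \<subseteq> ball ?E v (Suc i)"
    by (rule ball_mono) simp
  have "card (ball ?E v (Suc i)) = card (ball ?E v i) + card (ball ?E v (Suc i) - ball ?E v i)"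
    using card_Diff_subset[OF fin sub] card_mono[OF fin sub] by simp
  then show ?case
    using Suc level_card_ge[OF assms(1-5) crit v, of i] by simp
qed simp

text \<open>One \<open>t\<close> serves both bounds: as a maximum of ball sizes it is attained by a
  ball to delete, and it limits all balls in the bipartite construction.\<close>

lemma max_colorable_ge_at_some_radius:
  fixes n k :: nat
  assumes n: "n \<ge> 2" and k: "k \<ge> 2"
  obtains t :: nat where "t \<ge> n * (k - 1) + 1"
    "max_colorable (n - 1) k + t \<le> max_colorable n k"
    "real t powr (1 / (real k - 1)) / (real t powr (1 / (real k - 1)) - 1)
       * (real (max_colorable (n - 2) k) + 1) - 1 \<le> real (max_colorable n k)"
proof -
  have k1: "k \<ge> 1"
    using k by simp
  obtain G :: "nat pair_pre_digraph" where G: "pair_graph G" "no_short_odd_cycle k G"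
    "\<not> colorable n G" "card (pverts G) = Suc (max_colorable n k)"
    using obtain_minimal_non_colorable[OF k1] by blast
  interpret pair_graph G
    by fact
  let ?E = "parcs G" and ?V = "pverts G"
  have free: "odd_walk_free k ?E"
    using G(2) no_short_odd_cycle_iff by simp
  have EV: "?E \<subseteq> ?V \<times> ?V"
    using wellformed' by auto
  have finB: "finite (ball ?E v i)" and subB: "ball ?E v i \<subseteq> ?V" if "v \<in> ?V" for v i
    using ball_subset[OF EV that] pair_finite_verts finite_subset by blast+
  have crit: "colorable n (induced G W)" if "W \<subset> ?V" for W
  proof -
    have "card W < card ?V"
      using that pair_finite_verts by (rule psubset_card_mono[rotated])
    then show ?thesis
      using colorable_induced[OF k1 G(1,2)] that G(4) by auto
  qed
  have large: "max_colorable m k < card W" if "W \<subseteq> ?V" "\<not> colorable m (induced G W)" for m W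
    using colorable_induced[OF k1 G(1,2) that(1)] that(2) by (meson not_le)
  define t where "t = Max ((\<lambda>v. card (ball ?E v (k - 1))) ` ?V)"
  have "?V \<noteq> {}"
    using G(4) by auto
  then have "t \<in> (\<lambda>v. card (ball ?E v (k - 1))) ` ?V"
    unfolding t_def using pair_finite_verts by (intro Max_in) auto
  then obtain v where v: "v \<in> ?V" "t = card (ball ?E v (k - 1))"
    by auto
  have t_ge: "card (ball ?E u (k - 1)) \<le> t" if "u \<in> ?V" for u
    unfolding t_def using that pair_finite_verts by (intro Max_ge) auto
  have t: "t \<ge> n * (k - 1) + 1"
    using ball_card_ge[OF G(1,2) k1 n G(3) crit v(1), of "k - 1"] v(2) by simp

  have bound1: "max_colorable (n - 1) k + t \<le> max_colorable n k"
  proof -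
    let ?B = "ball ?E v (k - 1)"
    have "\<not> colorable (n - 1) (induced G (?V - ?B))"
    proof
      assume "colorable (n - 1) (induced G (?V - ?B))"
      then obtain c where c: "\<And>w. w \<in> ?V - ?B \<Longrightarrow> c w < n - 1"
        "\<And>x y. (x, y) \<in> ?E \<Longrightarrow> x \<in> ?V - ?B \<Longrightarrow> y \<in> ?V - ?B \<Longrightarrow> c x \<noteq> c y"
        using colorable_inducedE by metis
      \<comment> \<open>The new colour \<open>n - 1\<close> goes to the outermost level; colour 0
        can be reused further in, where no vertex has a neighbour outside.\<close>
      define c' where "c' = (\<lambda>w. if w \<in> ?B then
        if even (distance ?E v w) = even (k - 1) then n - 1 else 0 else c w)"
      have new: "n - 1 \<notin> c ` (ball ?E v (Suc (k - 1)) - ?B)"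
        using c(1) subB[OF v(1)] by fastforce
      have "n - 1 \<noteq> 0"
        using n by simp
      then have "c' x \<noteq> c' y" if "(x, y) \<in> ?E" for x y
        using extend_coloring_over_ball[OF sym_parcs free k1 order_refl _ new _ c'_def that]
          c(2) wellformed' by blast
      moreover have "c' ` ?V \<subseteq> {..<n}"
        using c(1) n by (fastforce simp: c'_def)
      ultimately show False
        using G(3) unfolding colorable_def by blast
    qed
    then have "max_colorable (n - 1) k < card (?V - ?B)"
      by (intro large) auto
    also have "card (?V - ?B) = card ?V - t"
      using subB[OF v(1)] finB[OF v(1)] v(2) by (simp add: card_Diff_subset)
    finally show ?thesis
      using G(4) by simp
  qed

  define r where "r = real t powr (1 / (real k - 1))"
  \<comment> \<open>This yields \<open>t > 1\<close>, hence \<open>r > 1\<close>, which permits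
    division by \<open>r - 1\<close>.\<close>
  have "1 * 1 \<le> n * (k - 1)"
    using n k by (intro mult_le_mono) auto
  then have "t > 1"
    using t by linarith
  then have r1: "r > 1"
    unfolding r_def using k by (intro gr_one_powr) auto
  have "r ^ (k - 1) = r powr real (k - 1)"
    using r1 by (simp add: powr_realpow)
  also have "\<dots> = real t"
    unfolding r_def using k \<open>t > 1\<close> by (simp add: powr_powr of_nat_diff)
  finally have r_pow: "r ^ (k - 1) = real t" .

  have "\<exists>X\<subseteq>?V. (\<exists>c :: nat \<Rightarrow> nat. (\<forall>x. c x < 2) \<and> (\<forall>(x, y)\<in>Restr ?E X. c x \<noteq> c y))
           \<and> real (card ?V) \<le> r * real (card X)"
    using pair_finite_verts sym_parcs free k
  proof (rule large_bipartite_subset)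
    show "finite (ball ?E u (k - 1)) \<and> real (card (ball ?E u (k - 1))) \<le> r ^ (k - 1)" if "u \<in> ?V" for u
      using that finB t_ge r_pow by simp
    show "r \<ge> 0"
      using r1 by simp
  qed
  then obtain X d where X: "X \<subseteq> ?V" "\<forall>x. d x < (2::nat)" "\<forall>(x, y)\<in>Restr ?E X. d x \<noteq> d y"
    "real (card ?V) \<le> r * real (card X)"
    by blast
  have "\<not> colorable (n - 2) (induced G (?V - X))"
  proof
    assume "colorable (n - 2) (induced G (?V - X))"
    then obtain c where c: "\<And>w. w \<in> ?V - X \<Longrightarrow> c w < n - 2"
      "\<And>x y. (x, y) \<in> ?E \<Longrightarrow> x \<in> ?V - X \<Longrightarrow> y \<in> ?V - X \<Longrightarrow> c x \<noteq> c y"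
      using colorable_inducedE by metis
    \<comment> \<open>The two colours on \<open>X\<close> are shifted to \<open>n - 2\<close> and
      \<open>n - 1\<close>, above those of the complement.\<close>
    define c' where "c' w = (if w \<in> X then n - 2 + d w else c w)" for w
    have "c' x \<noteq> c' y" if "(x, y) \<in> ?E" for x y
    proof -
      have "x \<in> ?V" "y \<in> ?V"
        using that wellformed' by auto
      then show ?thesis
        using c(1)[of x] c(1)[of y] c(2)[OF that] X(3) that by (auto simp: c'_def)
    qed
    moreover have "c' w < n" if "w \<in> ?V" for w
      using X(2)[rule_format, of w] c(1)[of w] that n by (auto simp: c'_def)
    then have "c' ` ?V \<subseteq> {..<n}"
      by auto
    ultimately show False
      using G(3) unfolding colorable_def by blast
  qed
  then have "max_colorable (n - 2) k < card (?V - X)"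
    by (intro large) auto
  also have "card (?V - X) = card ?V - card X"
    using X(1) pair_finite_verts by (simp add: card_Diff_subset finite_subset)
  finally have "real (max_colorable (n - 2) k) + 1 \<le> real (card ?V) - real (card X)"
    using card_mono[OF pair_finite_verts X(1)] by linarith
  \<comment> \<open>Since \<open>card ?V\<close> is at most \<open>r * card X\<close>, multiplying
    by \<open>r\<close> bounds the right side by \<open>(r - 1) * card ?V\<close>, eliminating
    \<open>card X\<close>.\<close>
  then have "r * (real (max_colorable (n - 2) k) + 1) \<le> r * (real (card ?V) - real (card X))"
    using r1 by (intro mult_left_mono) auto
  also have "\<dots> \<le> (real (max_colorable n k) + 1) * (r - 1)"
    using X(4) G(4) by (simp add: algebra_simps)
  finally have "r / (r - 1) * (real (max_colorable (n - 2) k) + 1) \<le> real (max_colorable n k) + 1"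
    using r1 by (simp add: field_simps)
  then show ?thesis
    using that[OF t bound1] unfolding r_def by simp
qed

(* The minimum over t exists, since the values of the maximum tend to infinity with t. *)
theorem theorem1:
  fixes n k :: nat
  assumes "n \<ge> 2" and "k \<ge> 2"
  shows "real (max_colorable n k) \<ge>
    (LEAST y. y \<in> (\<lambda>t :: nat.
        max (real (max_colorable (n - 1) k) + real t)
            (real t powr (1 / (real k - 1)) / (real t powr (1 / (real k - 1)) - 1)
               * (real (max_colorable (n - 2) k) + 1) - 1))
      ` {t. t \<ge> n * (k - 1) + 1})"
proof -
  define g where "g = (\<lambda>t :: nat. max (real (max_colorable (n - 1) k) + real t)
      (real t powr (1 / (real k - 1)) / (real t powr (1 / (real k - 1)) - 1)
        * (real (max_colorable (n - 2) k) + 1) - 1))"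
  let ?T = "{t. t \<ge> n * (k - 1) + 1}"
  obtain t where t: "t \<in> ?T" "g t \<le> real (max_colorable n k)"
  proof (rule max_colorable_ge_at_some_radius[OF assms])
    fix t assume "t \<ge> n * (k - 1) + 1"
      "max_colorable (n - 1) k + t \<le> max_colorable n k"
      "real t powr (1 / (real k - 1)) / (real t powr (1 / (real k - 1)) - 1)
       * (real (max_colorable (n - 2) k) + 1) - 1 \<le> real (max_colorable n k)"
    then show thesis
      by (intro that) (simp_all add: g_def flip: of_nat_add)
  qed
  \<comment> \<open>As \<open>g s\<close> is at least \<open>s\<close>, only finitely many
    \<open>s\<close> reach a value up to \<open>g t\<close>; the minimum over these is the minimum
    over all of \<open>?T\<close>.\<close>
  define F where "F = {s \<in> ?T. g s \<le> g t}"
  have "real s \<le> g s" for s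
    by (simp add: g_def max_def)
  then have "F \<subseteq> {..nat \<lfloor>g t\<rfloor>}"
    unfolding F_def by (auto intro: le_nat_floor order_trans)
  then have F: "finite (g ` F)" "t \<in> F"
    using finite_subset t(1) by (auto simp: F_def)
  have "(LEAST y. y \<in> g ` ?T) = Min (g ` F)"
  proof (rule Least_equality)
    have "Min (g ` F) \<in> g ` F"
      using F by (intro Min_in) auto
    then show "Min (g ` F) \<in> g ` ?T"
      by (auto simp: F_def)
    have min: "Min (g ` F) \<le> g s" if "s \<in> F" for s
      using F(1) that by simp
    show "Min (g ` F) \<le> y" if "y \<in> g ` ?T" for y
    proof -
      obtain s where s: "s \<in> ?T" "y = g s"
        using \<open>y \<in> g ` ?T\<close> by blast
      show ?thesis
        using min[of s] min[OF F(2)] s by (cases "g s \<le> g t") (auto simp: F_def)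
    qed
  qed
  also have "\<dots> \<le> g t"
    using F by simp
  finally show ?thesis
    using t(2) unfolding g_def by linarith
qed

end
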